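(* Every kite is a subdirect product of a system of subdirectly irreducible kites.
   Context: $\mathbb N=\{0,1,2,\dots\}$. A residuated lattice is an algebra $\mathbf G=(G;\wedge,\vee,\cdot,\backslash,/,e)$ such that $(G;\wedge,\vee)$ is a lattice, $(G;\cdot,e)$ is a monoid, and $x\cdot y\le z$ iff $y\le x\backslash z$ iff $x\le z/y$ for all $x,y,z\in G$. It is integral if $x\le e$ for all $x\in G$. A non-trivial (more than one element) residuated lattice is subdirectly irreducible if it has a least non-identity congruence (every kite is non-trivial). An algebra $\mathbf A$ is a subdirect product of a system $\{\mathbf A_s: s\in S\}$ if there is an embedding of $\mathbf A$ into $\prod_{s\in S}\mathbf A_s$ whose composition with every projection is surjective. A kite is any algebra $K^\lambda_{I_0,I_1}(\mathbf G)$, where $\mathbf G$ is an integral residuated lattice, $I_1\subseteq I_0$ are sets (possibly empty) and $\lambda\colon I_1\to I_0$ is injective; it is the following integral residuated lattice. For $n\ge1$ put $I_{n+1}=\{i\in I_n: \lambda(i)\in I_n\}$. Then $\lambda^{m-n}$ is a well-defined injective map $I_m\to I_n$ for $n\le m$; $\lambda^{-m}$ denotes the inverse of $\lambda^m$ on its image. The universe is the disjoint union $\biguplus_{n\in\mathbb N}G^{I_n}$ (different $n$ always give disjoint parts; if $I_n=\emptyset$, $G^{I_n}$ is a singleton), with elements written $\langle x_i: i\in I_n\rangle$. Order: $\langle x_i: i\in I_n\rangle\le\langle y_i: i\in I_m\rangle$ iff $m<n$, or $m=n$ and $x_i\le y_i$ for all $i\in I_n$. Unit: $1\in G^{I_0}$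 with all coordinates $e$. Product: $\langle x_i: i\in I_m\rangle\cdot\langle y_i: i\in I_n\rangle=\langle x_{\lambda^n(i)}y_i: i\in I_{m+n}\rangle$. Right division: $\langle y_i: i\in I_n\rangle/\!/\langle x_i: i\in I_m\rangle$ is $1$ if $m>n$; if $m\le n$ it is the element of $G^{I_{n-m}}$ with $i$-th coordinate $y_{\lambda^{-m}(i)}/x_{\lambda^{-m}(i)}$ if $i\in\lambda^m(I_n)$ and $e$ otherwise. Left division: $\langle y_i: i\in I_n\rangle\backslash\!\backslash\langle x_i: i\in I_m\rangle$ is $1$ if $n>m$; if $n\le m$ it is the element of $G^{I_{m-n}}$ with $i$-th coordinate $y_{\lambda^{m-n}(i)}\backslash x_i$ if $i\in I_m$ and $e$ otherwise. The kites in the system may be built from different integral residuated lattices, sets and injections. *)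

theory Defs
  imports "HOL-Algebra.Group"
begin

section \<open>Residuated lattices\<close>

record 'a rl = "'a monoid" +
  rl_meet :: "'a \<Rightarrow> 'a \<Rightarrow> 'a"
  rl_join :: "'a \<Rightarrow> 'a \<Rightarrow> 'a"
  rl_ldiv :: "'a \<Rightarrow> 'a \<Rightarrow> 'a"
  rl_rdiv :: "'a \<Rightarrow> 'a \<Rightarrow> 'a"

text \<open>\<open>rl_ldiv G x z\<close> is \<open>x\<close> under \<open>z\<close> (the largest \<open>y\<close> with \<open>x y \<le> z\<close>) and
  \<open>rl_rdiv G z y\<close> is \<open>z / y\<close> (the largest \<open>x\<close> with \<open>x y \<le> z\<close>).\<close>

definition rl_le :: "('a, 'm) rl_scheme \<Rightarrow> 'a \<Rightarrow> 'a \<Rightarrow> bool" where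
  "rl_le G x y \<longleftrightarrow> rl_meet G x y = x"

locale residuated_lattice = monoid G for G (structure) +
  assumes meet_closed: "\<lbrakk>x \<in> carrier G; y \<in> carrier G\<rbrakk> \<Longrightarrow> rl_meet G x y \<in> carrier G"
    and join_closed: "\<lbrakk>x \<in> carrier G; y \<in> carrier G\<rbrakk> \<Longrightarrow> rl_join G x y \<in> carrier G"
    and ldiv_closed: "\<lbrakk>x \<in> carrier G; y \<in> carrier G\<rbrakk> \<Longrightarrow> rl_ldiv G x y \<in> carrier G"
    and rdiv_closed: "\<lbrakk>x \<in> carrier G; y \<in> carrier G\<rbrakk> \<Longrightarrow> rl_rdiv G x y \<in> carrier G"
    and meet_comm: "\<lbrakk>x \<in> carrier G; y \<in> carrier G\<rbrakk> \<Longrightarrow> rl_meet G x y = rl_meet G y x"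
    and join_comm: "\<lbrakk>x \<in> carrier G; y \<in> carrier G\<rbrakk> \<Longrightarrow> rl_join G x y = rl_join G y x"
    and meet_assoc: "\<lbrakk>x \<in> carrier G; y \<in> carrier G; z \<in> carrier G\<rbrakk>
      \<Longrightarrow> rl_meet G (rl_meet G x y) z = rl_meet G x (rl_meet G y z)"
    and join_assoc: "\<lbrakk>x \<in> carrier G; y \<in> carrier G; z \<in> carrier G\<rbrakk>
      \<Longrightarrow> rl_join G (rl_join G x y) z = rl_join G x (rl_join G y z)"
    and meet_join: "\<lbrakk>x \<in> carrier G; y \<in> carrier G\<rbrakk> \<Longrightarrow> rl_meet G x (rl_join G x y) = x"
    and join_meet: "\<lbrakk>x \<in> carrier G; y \<in> carrier G\<rbrakk> \<Longrightarrow> rl_join G x (rl_meet G x y) = x"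
    and ldiv_iff: "\<lbrakk>x \<in> carrier G; y \<in> carrier G; z \<in> carrier G\<rbrakk>
      \<Longrightarrow> rl_le G (x \<otimes> y) z \<longleftrightarrow> rl_le G y (rl_ldiv G x z)"
    and rdiv_iff: "\<lbrakk>x \<in> carrier G; y \<in> carrier G; z \<in> carrier G\<rbrakk>
      \<Longrightarrow> rl_le G (x \<otimes> y) z \<longleftrightarrow> rl_le G x (rl_rdiv G z y)"

locale integral_residuated_lattice = residuated_lattice +
  assumes integral: "x \<in> carrier G \<Longrightarrow> rl_le G x \<one>"


section \<open>Subdirect irreducibility and subdirect products\<close>

definition compatible :: "('a \<Rightarrow> 'a \<Rightarrow> 'a) \<Rightarrow> 'a rel \<Rightarrow> bool" where
  "compatible f r \<longleftrightarrow> (\<forall>(x, x') \<in> r. \<forall>(y, y') \<in> r. (f x y, f x' y') \<in> r)"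

definition rl_congruence :: "('a, 'm) rl_scheme \<Rightarrow> 'a rel \<Rightarrow> bool" where
  "rl_congruence A r \<longleftrightarrow> equiv (carrier A) r \<and>
     compatible (rl_meet A) r \<and> compatible (rl_join A) r \<and> compatible (mult A) r \<and>
     compatible (rl_ldiv A) r \<and> compatible (rl_rdiv A) r"

definition subdirectly_irreducible :: "('a, 'm) rl_scheme \<Rightarrow> bool" where
  "subdirectly_irreducible A \<longleftrightarrow>
     (\<exists>x \<in> carrier A. \<exists>y \<in> carrier A. x \<noteq> y) \<and>
     (\<exists>r. rl_congruence A r \<and> r \<noteq> Id_on (carrier A) \<and>
          (\<forall>s. rl_congruence A s \<and> s \<noteq> Id_on (carrier A) \<longrightarrow> r \<subseteq> s))"

definition rl_hom :: "('a, 'm) rl_scheme \<Rightarrow> ('b, 'n) rl_scheme \<Rightarrow> ('a \<Rightarrow> 'b) set" where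
  "rl_hom A B = {h \<in> hom A B. h \<one>\<^bsub>A\<^esub> = \<one>\<^bsub>B\<^esub> \<and>
     (\<forall>x \<in> carrier A. \<forall>y \<in> carrier A.
        h (rl_meet A x y) = rl_meet B (h x) (h y) \<and>
        h (rl_join A x y) = rl_join B (h x) (h y) \<and>
        h (rl_ldiv A x y) = rl_ldiv B (h x) (h y) \<and>
        h (rl_rdiv A x y) = rl_rdiv B (h x) (h y))}"

definition rl_product :: "'s set \<Rightarrow> ('s \<Rightarrow> ('b, 'm) rl_scheme) \<Rightarrow> ('s \<Rightarrow> 'b) rl" where
  "rl_product S F =
     \<lparr>carrier = (\<Pi>\<^sub>E s\<in>S. carrier (F s)),
      mult = (\<lambda>x y. \<lambda>s\<in>S. x s \<otimes>\<^bsub>F s\<^esub> y s),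
      one = (\<lambda>s\<in>S. \<one>\<^bsub>F s\<^esub>),
      rl_meet = (\<lambda>x y. \<lambda>s\<in>S. rl_meet (F s) (x s) (y s)),
      rl_join = (\<lambda>x y. \<lambda>s\<in>S. rl_join (F s) (x s) (y s)),
      rl_ldiv = (\<lambda>x y. \<lambda>s\<in>S. rl_ldiv (F s) (x s) (y s)),
      rl_rdiv = (\<lambda>x y. \<lambda>s\<in>S. rl_rdiv (F s) (x s) (y s))\<rparr>"

definition subdirect_product ::
    "('a, 'm) rl_scheme \<Rightarrow> 's set \<Rightarrow> ('s \<Rightarrow> ('b, 'n) rl_scheme) \<Rightarrow> bool" where
  "subdirect_product A S F \<longleftrightarrow>
     (\<exists>h \<in> rl_hom A (rl_product S F).
        inj_on h (carrier A) \<and> (\<forall>s\<in>S. (\<lambda>x. h x s) ` carrier A = carrier (F s)))"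


section \<open>Kites\<close>

fun kite_index :: "'i set \<Rightarrow> 'i set \<Rightarrow> ('i \<Rightarrow> 'i) \<Rightarrow> nat \<Rightarrow> 'i set" where
  "kite_index I0 I1 l 0 = I0"
| "kite_index I0 I1 l (Suc 0) = I1"
| "kite_index I0 I1 l (Suc (Suc n)) =
     {i \<in> kite_index I0 I1 l (Suc n). l i \<in> kite_index I0 I1 l (Suc n)}"

text \<open>The element \<open>\<langle>x\<^sub>i : i \<in> I\<^sub>n\<rangle>\<close> is the pair \<open>(n, x)\<close> with \<open>x\<close> extensional on \<open>I\<^sub>n\<close>; the
  tag \<open>n\<close> keeps the components of the union disjoint.  The map \<open>l\<close> is a total function, but
  only its values on \<open>I\<^sub>1\<close> are used: its \<open>n\<close>-th iterate is applied to elements of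
  \<open>I\<^sub>n\<close> only, and \<open>\<lambda>\<^sup>-\<^sup>m\<close> is \<open>inv_into I\<^sub>m (l ^^ m)\<close>.  Meet and join are those of the order in
  \<open>kite_le_iff\<close> below.\<close>

definition kite ::
    "('g, 'm) rl_scheme \<Rightarrow> 'i set \<Rightarrow> 'i set \<Rightarrow> ('i \<Rightarrow> 'i) \<Rightarrow> (nat \<times> ('i \<Rightarrow> 'g)) rl" where
  "kite G I0 I1 l = (let I = kite_index I0 I1 l; u = (0, \<lambda>i\<in>I 0. \<one>\<^bsub>G\<^esub>) in
     \<lparr>carrier = (SIGMA n:UNIV. \<Pi>\<^sub>E i\<in>I n. carrier G),
      mult = (\<lambda>(m, x) (n, y). (m + n, \<lambda>i\<in>I (m + n). x ((l ^^ n) i) \<otimes>\<^bsub>G\<^esub> y i)),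
      one = u,
      rl_meet = (\<lambda>(m, x) (n, y).
        if m < n then (n, y) else if n < m then (m, x)
        else (m, \<lambda>i\<in>I m. rl_meet G (x i) (y i))),
      rl_join = (\<lambda>(m, x) (n, y).
        if m < n then (m, x) else if n < m then (n, y)
        else (m, \<lambda>i\<in>I m. rl_join G (x i) (y i))),
      rl_ldiv = (\<lambda>(n, y) (m, x).
        if n > m then u
        else (m - n, \<lambda>i\<in>I (m - n).
               if i \<in> I m then rl_ldiv G (y ((l ^^ (m - n)) i)) (x i) else \<one>\<^bsub>G\<^esub>)),
      rl_rdiv = (\<lambda>(n, y) (m, x).
        if m > n then u
        else (n - m, \<lambda>i\<in>I (n - m).
               if i \<in> (l ^^ m) ` I n
               then rl_rdiv G (y (inv_into (I m) (l ^^ m) i)) (x (inv_into (I m) (l ^^ m) i))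
               else \<one>\<^bsub>G\<^esub>))\<rparr>)"

definition is_kite :: "(nat \<times> ('i \<Rightarrow> 'g)) rl \<Rightarrow> bool" where
  "is_kite A \<longleftrightarrow> (\<exists>(G :: 'g rl) I0 I1 l.
     integral_residuated_lattice G \<and> I1 \<subseteq> I0 \<and> l \<in> I1 \<rightarrow> I0 \<and> inj_on l I1 \<and>
     A = kite G I0 I1 l)"


section \<open>Kites are integral residuated lattices\<close>

context residuated_lattice
begin

lemma meet_idem: "x \<in> carrier G \<Longrightarrow> rl_meet G x x = x"
  by (metis join_meet meet_closed meet_join)

lemma join_idem: "x \<in> carrier G \<Longrightarrow> rl_join G x x = x"
  by (metis join_meet join_closed meet_join)

end

lemma kite_le_iff:
  assumes "(n, x) \<in> carrier (kite G I0 I1 l)" "(m, y) \<in> carrier (kite G I0 I1 l)"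
  shows "rl_le (kite G I0 I1 l) (n, x) (m, y) \<longleftrightarrow>
     m < n \<or> m = n \<and> (\<forall>i \<in> kite_index I0 I1 l n. rl_le G (x i) (y i))"
proof (cases "m = n")
  case True
  have "x \<in> extensional (kite_index I0 I1 l n)"
    using assms by (auto simp: kite_def Let_def PiE_def)
  then have "(\<lambda>i\<in>kite_index I0 I1 l n. rl_meet G (x i) (y i)) = x \<longleftrightarrow>
      (\<forall>i \<in> kite_index I0 I1 l n. rl_meet G (x i) (y i) = x i)"
    by (auto simp: fun_eq_iff restrict_def extensional_def)
  then show ?thesis
    using True by (simp add: rl_le_def kite_def Let_def)
qed (auto simp: rl_le_def kite_def Let_def)

context
  fixes I0 I1 :: "'i set" and l :: "'i \<Rightarrow> 'i"
  assumes sub: "I1 \<subseteq> I0" and map: "l \<in> I1 \<rightarrow> I0" and inj: "inj_on l I1"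
begin

abbreviation (input) "I \<equiv> kite_index I0 I1 l"

lemma kite_index_antimono: "n \<le> m \<Longrightarrow> I m \<subseteq> I n"
proof (rule lift_Suc_antimono_le)
  show "I (Suc k) \<subseteq> I k" for k
    using sub by (cases k) auto
qed

lemma kite_index_step: "i \<in> I (Suc n) \<Longrightarrow> l i \<in> I n"
  using map by (cases n) auto

lemma kite_index_funpow: "i \<in> I (m + n) \<Longrightarrow> (l ^^ n) i \<in> I m"
proof (induction n arbitrary: i)
  case (Suc n)
  then show ?case
    using kite_index_step[of i "m + n"] by (simp add: funpow_Suc_right del: funpow.simps)
qed simp

lemma kite_index_inj: "inj_on (l ^^ n) (I n)"
proof (induction n)
  case (Suc n)
  have "inj_on l (I (Suc n))"
    using inj kite_index_antimono[of "Suc 0" "Suc n"] by (auto intro: inj_on_subset)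
  moreover have "inj_on (l ^^ n) (l ` I (Suc n))"
    using Suc kite_index_step by (auto intro: inj_on_subset)
  ultimately show ?case
    unfolding funpow_Suc_right by (rule comp_inj_on)
qed simp

lemma kite_index_inv:
  assumes "m \<le> n" "i \<in> I n" shows "inv_into (I m) (l ^^ m) ((l ^^ m) i) = i"
  using assms kite_index_antimono kite_index_inj by (meson inv_into_f_f subsetD)

lemma kite_integral_residuated_lattice:
  fixes G :: "('g, 'm) rl_scheme"
  assumes "integral_residuated_lattice G"
  shows "integral_residuated_lattice (kite G I0 I1 l)"
proof -
  interpret G: integral_residuated_lattice G by fact
  let ?K = "kite G I0 I1 l"
  note kd = kite_def Let_def
  have anti: "i \<in> I m \<Longrightarrow> n \<le> m \<Longrightarrow> i \<in> I n" for i m n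
    using kite_index_antimono by blast
  have mem: "x i \<in> carrier G" if "x \<in> I n \<rightarrow>\<^sub>E carrier G" "i \<in> I n" for x n i
    using that by auto
  have eqI: "x = restrict f (I n)"
    if "x \<in> I n \<rightarrow>\<^sub>E carrier G" "\<And>i. i \<in> I n \<Longrightarrow> f i = x i" for x n f
    using that by (auto simp: fun_eq_iff PiE_def extensional_def)
  have carr: "(n, x) \<in> carrier ?K \<longleftrightarrow> x \<in> I n \<rightarrow>\<^sub>E carrier G" for n x
    by (auto simp: kd)
  have mult: "(m, x) \<otimes>\<^bsub>?K\<^esub> (n, y) = (m + n, \<lambda>i\<in>I (m + n). x ((l ^^ n) i) \<otimes>\<^bsub>G\<^esub> y i)"
    for m n x y by (simp add: kd)
  have multc: "(\<lambda>i\<in>I (m + n). x ((l ^^ n) i) \<otimes>\<^bsub>G\<^esub> y i) \<in> I (m + n) \<rightarrow>\<^sub>E carrier G"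
    if "x \<in> I m \<rightarrow>\<^sub>E carrier G" "y \<in> I n \<rightarrow>\<^sub>E carrier G" for m n x y
  proof -
    have "x ((l ^^ n) i) \<in> carrier G" "y i \<in> carrier G" if "i \<in> I (m + n)" for i
      using that \<open>x \<in> _\<close> \<open>y \<in> _\<close> kite_index_funpow[of i m n] anti[of i "m + n" n]
      by (simp_all add: mem)
    then show ?thesis by (simp add: restrict_PiE_iff)
  qed
  have ldivc: "rl_ldiv ?K (n, y) (m, x) \<in> carrier ?K"
    if "x \<in> I m \<rightarrow>\<^sub>E carrier G" "y \<in> I n \<rightarrow>\<^sub>E carrier G" for m n x y
  proof (cases "n > m")
    case False
    have "rl_ldiv G (y ((l ^^ (m - n)) i)) (x i) \<in> carrier G" if "i \<in> I m" for i
      using that False \<open>x \<in> _\<close> \<open>y \<in> _\<close> kite_index_funpow[of i n "m - n"]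
      by (simp add: mem G.ldiv_closed)
    then show ?thesis using False by (simp add: kd restrict_PiE_iff)
  qed (simp add: kd restrict_PiE_iff)
  have rdivc: "rl_rdiv ?K (n, y) (m, x) \<in> carrier ?K"
    if "x \<in> I m \<rightarrow>\<^sub>E carrier G" "y \<in> I n \<rightarrow>\<^sub>E carrier G" for m n x y
  proof (cases "n < m")
    case False
    have "rl_rdiv G (y i) (x i) \<in> carrier G" if "i \<in> I n" for i
      using that False \<open>x \<in> _\<close> \<open>y \<in> _\<close> anti[of i n m]
      by (simp add: mem G.rdiv_closed)
    moreover have "inv_into (I m) (l ^^ m) ((l ^^ m) i) = i" if "i \<in> I n" for i
      using that False kite_index_inv[of m n] by simp
    ultimately show ?thesis using False by (auto simp: kd restrict_PiE_iff)
  qed (simp add: kd restrict_PiE_iff)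
  have top: "rl_le ?K (n, x) \<one>\<^bsub>?K\<^esub>" if "x \<in> I n \<rightarrow>\<^sub>E carrier G" for n x
  proof -
    have "(0, \<lambda>i\<in>I 0. \<one>\<^bsub>G\<^esub>) \<in> carrier ?K" by (simp add: carr del: kite_index.simps)
    moreover have "(n, x) \<in> carrier ?K" using that by (simp add: carr)
    moreover have "\<one>\<^bsub>?K\<^esub> = (0, \<lambda>i\<in>I 0. \<one>\<^bsub>G\<^esub>)" by (simp add: kd)
    ultimately show ?thesis
      by (auto simp: kite_le_iff G.integral mem[OF that] simp del: kite_index.simps)
  qed
  have mle: "rl_le ?K ((m, x) \<otimes>\<^bsub>?K\<^esub> (n, y)) (k, z) \<longleftrightarrow> k < m + n \<or> k = m + n \<and>
            (\<forall>i\<in>I k. rl_le G (x ((l ^^ n) i) \<otimes>\<^bsub>G\<^esub> y i) (z i))"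
    if c: "x \<in> I m \<rightarrow>\<^sub>E carrier G" "y \<in> I n \<rightarrow>\<^sub>E carrier G" "z \<in> I k \<rightarrow>\<^sub>E carrier G"
    for m n k x y z
  proof -
    have p: "(m + n, \<lambda>i\<in>I (m + n). x ((l ^^ n) i) \<otimes>\<^bsub>G\<^esub> y i) \<in> carrier ?K"
      unfolding carr using c(1,2) by (rule multc)
    have q: "(k, z) \<in> carrier ?K"
      unfolding carr by (fact c(3))
    show ?thesis
      unfolding mult kite_le_iff[OF p q] by (cases "k = m + n") simp_all
  qed
  have ldiv: "rl_le ?K ((m, x) \<otimes>\<^bsub>?K\<^esub> (n, y)) (k, z) \<longleftrightarrow>
              rl_le ?K (n, y) (rl_ldiv ?K (m, x) (k, z))"
    if c: "x \<in> I m \<rightarrow>\<^sub>E carrier G" "y \<in> I n \<rightarrow>\<^sub>E carrier G" "z \<in> I k \<rightarrow>\<^sub>E carrier G"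
    for m n k x y z
  proof (cases "m > k")
    case True
    then have "rl_ldiv ?K (m, x) (k, z) = \<one>\<^bsub>?K\<^esub>" by (simp add: kd)
    with True c show ?thesis
      by (simp add: top mle)
  next
    case False
    define w where "w = (\<lambda>i\<in>I (k - m).
      if i \<in> I k then rl_ldiv G (x ((l ^^ (k - m)) i)) (z i) else \<one>\<^bsub>G\<^esub>)"
    have e: "rl_ldiv ?K (m, x) (k, z) = (k - m, w)"
      using False by (simp add: kd w_def)
    have w: "w \<in> I (k - m) \<rightarrow>\<^sub>E carrier G"
      using ldivc[OF c(3,1)] e by (simp add: carr)
    have main: "(\<forall>i\<in>I k. rl_le G (x ((l ^^ n) i) \<otimes>\<^bsub>G\<^esub> y i) (z i)) \<longleftrightarrow>
          (\<forall>i\<in>I n. rl_le G (y i) (w i))" if k: "k = m + n"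
    proof -
      have "rl_le G (y i) (w i)" if "i \<in> I n" "i \<notin> I k" for i
        using that k mem[OF c(2)] G.integral by (auto simp: w_def)
      moreover have "rl_le G (x ((l ^^ n) i) \<otimes>\<^bsub>G\<^esub> y i) (z i) \<longleftrightarrow> rl_le G (y i) (w i)"
        if i: "i \<in> I k" for i
      proof -
        have "i \<in> I n" using i k anti by simp
        moreover have "(l ^^ n) i \<in> I m" using i k kite_index_funpow by blast
        ultimately show ?thesis
          using i k mem[OF c(1)] mem[OF c(2)] mem[OF c(3)] by (simp add: w_def G.ldiv_iff)
      qed
      moreover have "I k \<subseteq> I n" using k anti by auto
      ultimately show ?thesis by blast
    qed
    note mle[OF c]
    moreover have "rl_le ?K (n, y) (k - m, w) \<longleftrightarrow> k - m < n \<or> k - m = n \<and>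
            (\<forall>i\<in>I n. rl_le G (y i) (w i))"
      using c w by (simp add: kite_le_iff carr)
    ultimately show ?thesis
      using main False e by (auto simp: not_less)
  qed
  have rdiv: "rl_le ?K ((m, x) \<otimes>\<^bsub>?K\<^esub> (n, y)) (k, z) \<longleftrightarrow>
              rl_le ?K (m, x) (rl_rdiv ?K (k, z) (n, y))"
    if c: "x \<in> I m \<rightarrow>\<^sub>E carrier G" "y \<in> I n \<rightarrow>\<^sub>E carrier G" "z \<in> I k \<rightarrow>\<^sub>E carrier G"
    for m n k x y z
  proof (cases "n > k")
    case True
    then have "rl_rdiv ?K (k, z) (n, y) = \<one>\<^bsub>?K\<^esub>" by (simp add: kd)
    with True c show ?thesis
      by (simp add: top mle)
  next
    case False
    define w where "w = (\<lambda>i\<in>I (k - n).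
      if i \<in> (l ^^ n) ` I k
      then rl_rdiv G (z (inv_into (I n) (l ^^ n) i)) (y (inv_into (I n) (l ^^ n) i))
      else \<one>\<^bsub>G\<^esub>)"
    have e: "rl_rdiv ?K (k, z) (n, y) = (k - n, w)"
      using False by (simp add: kd w_def)
    have w: "w \<in> I (k - n) \<rightarrow>\<^sub>E carrier G"
      using rdivc[OF c(2,3)] e by (simp add: carr)
    have main: "(\<forall>i\<in>I k. rl_le G (x ((l ^^ n) i) \<otimes>\<^bsub>G\<^esub> y i) (z i)) \<longleftrightarrow>
          (\<forall>j\<in>I m. rl_le G (x j) (w j))" if k: "k = m + n"
    proof -
      have "rl_le G (x j) (w j)" if "j \<in> I m" "j \<notin> (l ^^ n) ` I k" for j
        using that k mem[OF c(1)] G.integral by (auto simp: w_def)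
      moreover have "rl_le G (x ((l ^^ n) i) \<otimes>\<^bsub>G\<^esub> y i) (z i) \<longleftrightarrow>
          rl_le G (x ((l ^^ n) i)) (w ((l ^^ n) i))"
        if i: "i \<in> I k" for i
      proof -
        have "i \<in> I n" using i k anti by simp
        moreover have "(l ^^ n) i \<in> I m" using i k kite_index_funpow by blast
        moreover have "inv_into (I n) (l ^^ n) ((l ^^ n) i) = i"
          using i k kite_index_inv[of n k i] by simp
        ultimately show ?thesis
          using i k mem[OF c(1)] mem[OF c(2)] mem[OF c(3)] by (simp add: w_def G.rdiv_iff)
      qed
      moreover have "(l ^^ n) ` I k \<subseteq> I m" using k kite_index_funpow by auto
      ultimately show ?thesis by blast
    qed
    note mle[OF c]
    moreover have "rl_le ?K (m, x) (k - n, w) \<longleftrightarrow> k - n < m \<or> k - n = m \<and>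
            (\<forall>i\<in>I m. rl_le G (x i) (w i))"
      using c w by (simp add: kite_le_iff carr)
    ultimately show ?thesis
      using main False e by (auto simp: not_less)
  qed
  show ?thesis
  proof
    fix p q assume "p \<in> carrier ?K" "q \<in> carrier ?K"
    then obtain m x n y where pq: "p = (m, x)" "q = (n, y)"
      "x \<in> I m \<rightarrow>\<^sub>E carrier G" "y \<in> I n \<rightarrow>\<^sub>E carrier G"
      by (metis carr surj_pair)
    note mx = mem[OF pq(3)] and my = mem[OF pq(4)]
    show "p \<otimes>\<^bsub>?K\<^esub> q \<in> carrier ?K"
      unfolding pq(1,2) mult carr using pq(3,4) by (rule multc)
    show "rl_ldiv ?K p q \<in> carrier ?K" "rl_rdiv ?K p q \<in> carrier ?K"
      using pq ldivc rdivc by auto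
    show "rl_meet ?K p q \<in> carrier ?K" "rl_join ?K p q \<in> carrier ?K"
      using pq mx my by (auto simp: kd restrict_PiE_iff G.meet_closed G.join_closed)
    show "rl_meet ?K p q = rl_meet ?K q p" "rl_join ?K p q = rl_join ?K q p"
      using pq(1,2) mx my by (auto simp: kd G.meet_comm G.join_comm intro!: restrict_ext)
    show "rl_meet ?K p (rl_join ?K p q) = p" "rl_join ?K p (rl_meet ?K p q) = p"
      using pq mx my
      by (auto simp: kd G.meet_join G.join_meet G.meet_idem G.join_idem intro!: eqI[symmetric])
    fix r assume "r \<in> carrier ?K"
    then obtain k z where r: "r = (k, z)" "z \<in> I k \<rightarrow>\<^sub>E carrier G"
      by (metis carr surj_pair)
    note mz = mem[OF r(2)]
    show "rl_meet ?K (rl_meet ?K p q) r = rl_meet ?K p (rl_meet ?K q r)"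
      "rl_join ?K (rl_join ?K p q) r = rl_join ?K p (rl_join ?K q r)"
      using pq(1,2) r(1) mx my mz
      by (cases m n rule: linorder_cases; cases n k rule: linorder_cases;
          simp add: kd G.meet_assoc G.join_assoc cong: restrict_cong)+
    show "rl_le ?K (p \<otimes>\<^bsub>?K\<^esub> q) r \<longleftrightarrow> rl_le ?K q (rl_ldiv ?K p r)"
      "rl_le ?K (p \<otimes>\<^bsub>?K\<^esub> q) r \<longleftrightarrow> rl_le ?K p (rl_rdiv ?K r q)"
      using pq r ldiv rdiv by auto
    show "p \<otimes>\<^bsub>?K\<^esub> q \<otimes>\<^bsub>?K\<^esub> r = p \<otimes>\<^bsub>?K\<^esub> (q \<otimes>\<^bsub>?K\<^esub> r)"
    proof -
      have "x ((l ^^ n) ((l ^^ k) i)) \<otimes>\<^bsub>G\<^esub> y ((l ^^ k) i) \<otimes>\<^bsub>G\<^esub> z i =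
            x ((l ^^ (n + k)) i) \<otimes>\<^bsub>G\<^esub> (y ((l ^^ k) i) \<otimes>\<^bsub>G\<^esub> z i)" if i: "i \<in> I (m + n + k)" for i
      proof -
        have "(l ^^ (n + k)) i \<in> I m"
          using i kite_index_funpow[of i m "n + k"] by (simp add: add.assoc)
        moreover have "(l ^^ k) i \<in> I n"
          using i kite_index_funpow[of i n k] anti[of i "m + n + k" "n + k"] by simp
        moreover have "i \<in> I k" using i anti by simp
        ultimately show ?thesis
          using mx my mz by (simp add: funpow_add G.m_assoc)
      qed
      moreover have "(l ^^ k) i \<in> I (m + n)" "i \<in> I (n + k)" if "i \<in> I (m + n + k)" for i
        using that kite_index_funpow anti[of i "m + n + k" "n + k"] by auto
      ultimately show ?thesis
        using pq(1,2) r(1) by (auto simp: mult add.assoc intro!: restrict_ext)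
    qed
  next
    show one: "\<one>\<^bsub>?K\<^esub> \<in> carrier ?K" by (auto simp: kd)
    fix p assume "p \<in> carrier ?K"
    then obtain m x where p: "p = (m, x)" "x \<in> I m \<rightarrow>\<^sub>E carrier G"
      by (metis carr surj_pair)
    show "rl_le ?K p \<one>\<^bsub>?K\<^esub>" using p top by simp
    have o: "\<one>\<^bsub>?K\<^esub> = (0, \<lambda>i\<in>I 0. \<one>\<^bsub>G\<^esub>)" by (simp add: kd)
    show "\<one>\<^bsub>?K\<^esub> \<otimes>\<^bsub>?K\<^esub> p = p"
      using p kite_index_funpow[of _ 0 m]
      by (auto simp: o mult mem[OF p(2)] intro!: eqI[symmetric] simp del: kite_index.simps)
    show "p \<otimes>\<^bsub>?K\<^esub> \<one>\<^bsub>?K\<^esub> = p"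
      using p anti[of _ m 0]
      by (auto simp: o mult mem[OF p(2)] intro!: eqI[symmetric] simp del: kite_index.simps)
  qed
qed

end

end

theory Submission
  imports Defs
begin

text \<open>
  Two independent reductions split a kite over \<open>G\<close> with partial injection \<open>l\<close>.  On the side of the
  index set, a set \<open>C\<close> of indices that \<open>l\<close> neither enters nor leaves cuts out a smaller kite, and
  restricting all tuples to \<open>C\<close> is a surjective homomorphism.  On the side of the values, a
  congruence \<open>r\<close> of \<open>G\<close> acts coordinatewise and yields a surjection onto the kite over \<open>G/r\<close>.
  Doing both gives a surjection onto the kite over \<open>G/r\<close> with index set \<open>C\<close>
  (\<open>kite_map_hom\<close>, \<open>kite_map_surj\<close>).

  Such a factor is subdirectly irreducible as soon as \<open>C\<close> cannot be cut further and, for nonempty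
  \<open>C\<close>, the lattice \<open>G/r\<close> is subdirectly irreducible (\<open>kite_subdirectly_irreducible\<close>).  Indeed, each
  coordinate of level \<open>0\<close> carries a copy of \<open>G/r\<close> inside the kite.  A non-identity congruence of the
  kite identifies some element other than the unit with the unit, hence also everything above it, so
  it is non-trivial on the copy at some coordinate, where it then contains the monolith of \<open>G/r\<close>.
  Conjugating by the unit tuple of level \<open>1\<close> shifts coordinates along \<open>l\<close> in both directions, so the
  congruence contains the monolith at every coordinate.  If \<open>C\<close> is empty, the kite has exactly one
  element on each level; it is the negative cone of the integers, which is simple.

  These factors separate points.  The empty \<open>C\<close> remembers just the level of an element.  Two tuples of
  the same level that differ in the coordinate \<open>i\<close> are separated by the connected component \<open>C\<close> of
  \<open>i\<close> (\<open>indecomposable_component\<close>) together with a congruence maximal among those that keep the two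
  values at \<open>i\<close> apart; the quotient of \<open>G\<close> by it is subdirectly irreducible by Birkhoff's argument
  (\<open>separating_congruence\<close>).
\<close>

section \<open>Order and congruences of residuated lattices\<close>

context residuated_lattice
begin

lemma le_refl: "x \<in> carrier G \<Longrightarrow> rl_le G x x"
  by (simp add: rl_le_def meet_idem)

lemma le_antisym:
  "\<lbrakk>x \<in> carrier G; y \<in> carrier G; rl_le G x y; rl_le G y x\<rbrakk> \<Longrightarrow> x = y"
  by (metis rl_le_def meet_comm)

lemma le_trans:
  "\<lbrakk>x \<in> carrier G; y \<in> carrier G; z \<in> carrier G; rl_le G x y; rl_le G y z\<rbrakk> \<Longrightarrow> rl_le G x z"
  by (metis rl_le_def meet_assoc)

lemma meet_le2: "\<lbrakk>x \<in> carrier G; y \<in> carrier G\<rbrakk> \<Longrightarrow> rl_le G (rl_meet G x y) y"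
  by (metis rl_le_def meet_assoc meet_idem)

lemma join_eq_if_le: "\<lbrakk>x \<in> carrier G; y \<in> carrier G; rl_le G x y\<rbrakk> \<Longrightarrow> rl_join G x y = y"
  by (metis rl_le_def join_comm join_meet meet_comm)

end

lemma rl_congruence_equiv: "rl_congruence A r \<Longrightarrow> equiv (carrier A) r"
  by (simp add: rl_congruence_def)

lemma rl_congruence_mem:
  "\<lbrakk>rl_congruence A r; (x, y) \<in> r\<rbrakk> \<Longrightarrow> x \<in> carrier A \<and> y \<in> carrier A"
  by (auto simp: rl_congruence_def equiv_def)

lemma rl_congruence_refl: "\<lbrakk>rl_congruence A r; x \<in> carrier A\<rbrakk> \<Longrightarrow> (x, x) \<in> r"
  by (auto simp: rl_congruence_def equiv_def refl_on_def)

lemma rl_congruence_sym: "\<lbrakk>rl_congruence A r; (x, y) \<in> r\<rbrakk> \<Longrightarrow> (y, x) \<in> r"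
  by (auto simp: rl_congruence_def equiv_def dest: symD)

lemma rl_congruence_trans:
  "\<lbrakk>rl_congruence A r; (x, y) \<in> r; (y, z) \<in> r\<rbrakk> \<Longrightarrow> (x, z) \<in> r"
  by (auto simp: rl_congruence_def equiv_def dest: transD)

lemma compatibleD:
  "\<lbrakk>compatible f r; (x, x') \<in> r; (y, y') \<in> r\<rbrakk> \<Longrightarrow> (f x y, f x' y') \<in> r"
  unfolding compatible_def by blast

lemma compatibleI:
  "(\<And>x x' y y'. \<lbrakk>(x, x') \<in> r; (y, y') \<in> r\<rbrakk> \<Longrightarrow> (f x y, f x' y') \<in> r) \<Longrightarrow> compatible f r"
  unfolding compatible_def by blast

lemma rl_congruence_ops:
  assumes "rl_congruence A r" "(x, x') \<in> r" "(y, y') \<in> r"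
  shows "(rl_meet A x y, rl_meet A x' y') \<in> r" "(rl_join A x y, rl_join A x' y') \<in> r"
    "(x \<otimes>\<^bsub>A\<^esub> y, x' \<otimes>\<^bsub>A\<^esub> y') \<in> r"
    "(rl_ldiv A x y, rl_ldiv A x' y') \<in> r" "(rl_rdiv A x y, rl_rdiv A x' y') \<in> r"
  using assms by (simp_all add: rl_congruence_def compatibleD)

lemma rl_congruence_not_Id_on:
  assumes "rl_congruence A r"
  shows "r \<noteq> Id_on (carrier A) \<longleftrightarrow> (\<exists>(x, y) \<in> r. x \<noteq> y)"
  using rl_congruence_refl[OF assms] rl_congruence_mem[OF assms] by (auto simp: Id_on_def)

lemma (in residuated_lattice) rl_congruence_total:
  "rl_congruence G (carrier G \<times> carrier G)"
  using meet_closed join_closed ldiv_closed rdiv_closed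
  by (auto simp: rl_congruence_def compatible_def equiv_def refl_on_def sym_def trans_def)

lemma rl_congruence_Inter:
  assumes "R \<noteq> {}" "\<And>r. r \<in> R \<Longrightarrow> rl_congruence A r"
  shows "rl_congruence A (\<Inter>R)"
proof -
  have "equiv (carrier A) (\<Inter>R)"
    unfolding equiv_def
  proof (intro conjI)
    show "\<Inter>R \<subseteq> carrier A \<times> carrier A"
      using assms rl_congruence_mem by fast
    show "refl_on (carrier A) (\<Inter>R)"
      using assms rl_congruence_refl by (fastforce simp: refl_on_def)
    show "sym (\<Inter>R)"
      using assms(2) rl_congruence_sym by (fast intro!: symI)
    show "trans (\<Inter>R)"
      using assms(2) rl_congruence_trans by (fast intro!: transI)
  qed
  moreover have "compatible f (\<Inter>R)" if "\<And>r. r \<in> R \<Longrightarrow> compatible f r" for f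
    using that unfolding compatible_def by blast
  ultimately show ?thesis
    using assms(2) by (simp add: rl_congruence_def)
qed

text \<open>The least non-identity congruence is the intersection of all of them; a
  pair of distinct elements common to all keeps that intersection away from the identity.\<close>

lemma (in residuated_lattice) subdirectly_irreducibleI:
  assumes pq: "p \<in> carrier G" "q \<in> carrier G" "p \<noteq> q"
    and crit: "\<And>s. \<lbrakk>rl_congruence G s; s \<noteq> Id_on (carrier G)\<rbrakk> \<Longrightarrow> (p, q) \<in> s"
  shows "subdirectly_irreducible G"
proof -
  let ?R = "{s. rl_congruence G s \<and> s \<noteq> Id_on (carrier G)}"
  have "carrier G \<times> carrier G \<in> ?R"
    using rl_congruence_total rl_congruence_not_Id_on[OF rl_congruence_total] pq by auto
  then have c: "rl_congruence G (\<Inter>?R)"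
    by (intro rl_congruence_Inter) auto
  have "(p, q) \<in> \<Inter>?R"
    using crit by auto
  then have "\<Inter>?R \<noteq> Id_on (carrier G)"
    using c pq by (auto simp: rl_congruence_not_Id_on)
  with c pq show ?thesis
    unfolding subdirectly_irreducible_def by blast
qed

lemma (in residuated_lattice) ldiv_one: "x \<in> carrier G \<Longrightarrow> rl_ldiv G \<one> x = x"
  by (metis ldiv_closed ldiv_iff le_antisym le_refl l_one one_closed)

lemma (in residuated_lattice) rdiv_one: "x \<in> carrier G \<Longrightarrow> rl_rdiv G x \<one> = x"
  by (metis rdiv_closed rdiv_iff le_antisym le_refl r_one one_closed)

context integral_residuated_lattice
begin

lemma ldiv_eq_one_iff:
  "\<lbrakk>x \<in> carrier G; y \<in> carrier G\<rbrakk> \<Longrightarrow> rl_ldiv G x y = \<one> \<longleftrightarrow> rl_le G x y"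
  by (metis integral ldiv_closed ldiv_iff le_antisym le_refl one_closed r_one)

lemma rdiv_self: "x \<in> carrier G \<Longrightarrow> rl_rdiv G x x = \<one>"
  by (metis integral rdiv_closed rdiv_iff le_antisym le_refl one_closed l_one)

lemma ldiv_self: "x \<in> carrier G \<Longrightarrow> rl_ldiv G x x = \<one>"
  by (simp add: ldiv_eq_one_iff le_refl)

lemma join_one: "x \<in> carrier G \<Longrightarrow> rl_join G x \<one> = \<one>"
  by (simp add: integral join_eq_if_le)

text \<open>As in groups, congruences are controlled by the class of the unit: distinct \<open>p\<close>, \<open>q\<close> cannot
  satisfy both \<open>p \<le> q\<close> and \<open>q \<le> p\<close>, so one of the divisions \<open>p \ q\<close> and \<open>q \ p\<close> is not the unit,
  while a congruence that identifies \<open>p\<close> with \<open>q\<close> identifies both with \<open>p \ p = q \ q = 1\<close>.\<close>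

lemma congruence_one_pair:
  assumes "rl_congruence G s" "s \<noteq> Id_on (carrier G)"
  obtains a where "a \<noteq> \<one>" "(a, \<one>) \<in> s"
proof -
  obtain p q where pq: "(p, q) \<in> s" "p \<noteq> q"
    using assms(2) unfolding rl_congruence_not_Id_on[OF assms(1)] by blast
  then have c: "p \<in> carrier G" "q \<in> carrier G"
    using rl_congruence_mem[OF assms(1)] by blast+
  note refl = rl_congruence_refl[OF assms(1)] and ldiv = rl_congruence_ops(4)[OF assms(1)]
  have "(rl_ldiv G p q, rl_ldiv G q q) \<in> s"
    using ldiv[OF pq(1) refl[OF c(2)]] .
  moreover have "(rl_ldiv G q p, rl_ldiv G p p) \<in> s"
    using ldiv[OF rl_congruence_sym[OF assms(1) pq(1)] refl[OF c(1)]] .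
  moreover have "rl_ldiv G p q \<noteq> \<one> \<or> rl_ldiv G q p \<noteq> \<one>"
    using pq c by (auto simp: ldiv_eq_one_iff intro: le_antisym)
  ultimately show ?thesis
    using that c by (auto simp: ldiv_self)
qed

end

text \<open>The class of the unit is a filter: joining both sides of the pair with \<open>d\<close> turns \<open>c\<close> into \<open>d\<close>
  and fixes the unit.\<close>

lemma (in integral_residuated_lattice) congruence_one_upward:
  assumes "rl_congruence G s" "(c, \<one>) \<in> s" "d \<in> carrier G" "rl_le G c d"
  shows "(d, \<one>) \<in> s"
proof -
  have "c \<in> carrier G"
    using rl_congruence_mem[OF assms(1,2)] by simp
  moreover have "(rl_join G c d, rl_join G \<one> d) \<in> s"
    using rl_congruence_ops(2)[OF assms(1,2) rl_congruence_refl[OF assms(1,3)]] .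
  ultimately show ?thesis
    using assms(3,4) by (simp add: join_eq_if_le join_comm[of \<one> d] join_one)
qed

lemma (in integral_residuated_lattice) subdirectly_irreducible_one_pair:
  assumes "subdirectly_irreducible G"
  obtains a where "a \<in> carrier G" "a \<noteq> \<one>"
    "\<And>s. \<lbrakk>rl_congruence G s; s \<noteq> Id_on (carrier G)\<rbrakk> \<Longrightarrow> (a, \<one>) \<in> s"
proof -
  obtain r where r: "rl_congruence G r" "r \<noteq> Id_on (carrier G)"
    and least: "\<And>s. \<lbrakk>rl_congruence G s; s \<noteq> Id_on (carrier G)\<rbrakk> \<Longrightarrow> r \<subseteq> s"
    using assms unfolding subdirectly_irreducible_def by blast
  from r obtain a where a: "a \<noteq> \<one>" "(a, \<one>) \<in> r"
    by (rule congruence_one_pair)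
  show ?thesis
  proof (rule that)
    show "a \<in> carrier G"
      using rl_congruence_mem[OF r(1) a(2)] by simp
  qed (use a least in auto)
qed

section \<open>Homomorphisms and quotients\<close>

lemma rl_homD:
  assumes "h \<in> rl_hom A B"
  shows "x \<in> carrier A \<Longrightarrow> h x \<in> carrier B" "h \<one>\<^bsub>A\<^esub> = \<one>\<^bsub>B\<^esub>"
    and "\<lbrakk>x \<in> carrier A; y \<in> carrier A\<rbrakk> \<Longrightarrow> h (x \<otimes>\<^bsub>A\<^esub> y) = h x \<otimes>\<^bsub>B\<^esub> h y"
    and "\<lbrakk>x \<in> carrier A; y \<in> carrier A\<rbrakk> \<Longrightarrow> h (rl_meet A x y) = rl_meet B (h x) (h y)"
    and "\<lbrakk>x \<in> carrier A; y \<in> carrier A\<rbrakk> \<Longrightarrow> h (rl_join A x y) = rl_join B (h x) (h y)"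
    and "\<lbrakk>x \<in> carrier A; y \<in> carrier A\<rbrakk> \<Longrightarrow> h (rl_ldiv A x y) = rl_ldiv B (h x) (h y)"
    and "\<lbrakk>x \<in> carrier A; y \<in> carrier A\<rbrakk> \<Longrightarrow> h (rl_rdiv A x y) = rl_rdiv B (h x) (h y)"
  using assms by (auto simp: rl_hom_def hom_def)

lemma subdirect_productI:
  assumes hom: "\<And>s. s \<in> S \<Longrightarrow> f s \<in> rl_hom A (F s)"
    and surj: "\<And>s. s \<in> S \<Longrightarrow> f s ` carrier A = carrier (F s)"
    and sep: "\<And>x y. \<lbrakk>x \<in> carrier A; y \<in> carrier A; x \<noteq> y\<rbrakk> \<Longrightarrow> \<exists>s\<in>S. f s x \<noteq> f s y"
  shows "subdirect_product A S F"
proof -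
  let ?h = "\<lambda>x. \<lambda>s\<in>S. f s x"
  have "?h \<in> rl_hom A (rl_product S F)"
    using rl_homD[OF hom]
    by (auto simp: rl_hom_def hom_def rl_product_def restrict_PiE_iff intro!: restrict_ext)
  moreover have "inj_on ?h (carrier A)"
  proof (rule inj_onI)
    fix x y assume xy: "x \<in> carrier A" "y \<in> carrier A" "?h x = ?h y"
    have "f s x = f s y" if "s \<in> S" for s
      using fun_cong[OF xy(3), where x = s] that by simp
    then show "x = y"
      using sep xy(1,2) by blast
  qed
  moreover have "(\<lambda>x. ?h x s) ` carrier A = carrier (F s)" if "s \<in> S" for s
    using surj[OF that] that by simp
  ultimately show ?thesis
    unfolding subdirect_product_def by blast
qed

lemma (in residuated_lattice) rl_congruence_vimage:
  assumes h: "h \<in> rl_hom G B" and s: "rl_congruence B s"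
  shows "rl_congruence G {(x, y) \<in> carrier G \<times> carrier G. (h x, h y) \<in> s}"
    (is "rl_congruence G ?t")
proof -
  note hD = rl_homD[OF h]
  have "equiv (carrier G) ?t"
    using rl_congruence_refl[OF s] rl_congruence_sym[OF s] rl_congruence_trans[OF s] hD(1)
    by (intro equivI refl_onI symI transI) blast+
  then show ?thesis
    using rl_congruence_ops[OF s] hD
    by (simp add: rl_congruence_def) (intro conjI compatibleI;
      simp add: meet_closed join_closed ldiv_closed rdiv_closed)
qed

definition lift2 :: "'a rel \<Rightarrow> ('a \<Rightarrow> 'a \<Rightarrow> 'a) \<Rightarrow> 'a set \<Rightarrow> 'a set \<Rightarrow> 'a set" where
  "lift2 r f X Y = (\<Union>x\<in>X. \<Union>y\<in>Y. r `` {f x y})"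

definition rl_quotient :: "('a, 'm) rl_scheme \<Rightarrow> 'a rel \<Rightarrow> 'a set rl" where
  "rl_quotient A r =
     \<lparr>carrier = carrier A // r,
      mult = lift2 r (mult A),
      one = r `` {\<one>\<^bsub>A\<^esub>},
      rl_meet = lift2 r (rl_meet A),
      rl_join = lift2 r (rl_join A),
      rl_ldiv = lift2 r (rl_ldiv A),
      rl_rdiv = lift2 r (rl_rdiv A)\<rparr>"

lemma lift2_class:
  assumes r: "equiv C r" and f: "compatible f r" and xy: "x \<in> C" "y \<in> C"
  shows "lift2 r f (r `` {x}) (r `` {y}) = r `` {f x y}"
  unfolding lift2_def
proof (rule UN_equiv_class2[OF r r _ xy])
  show "congruent2 r r (\<lambda>x y. r `` {f x y})"
    using f equiv_class_eq[OF r] unfolding compatible_def congruent2_def by blast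
qed

lemma rl_quotient_class:
  assumes r: "rl_congruence A r" and xy: "x \<in> carrier A" "y \<in> carrier A"
  shows "rl_meet (rl_quotient A r) (r `` {x}) (r `` {y}) = r `` {rl_meet A x y}"
    "rl_join (rl_quotient A r) (r `` {x}) (r `` {y}) = r `` {rl_join A x y}"
    "(r `` {x}) \<otimes>\<^bsub>rl_quotient A r\<^esub> (r `` {y}) = r `` {x \<otimes>\<^bsub>A\<^esub> y}"
    "rl_ldiv (rl_quotient A r) (r `` {x}) (r `` {y}) = r `` {rl_ldiv A x y}"
    "rl_rdiv (rl_quotient A r) (r `` {x}) (r `` {y}) = r `` {rl_rdiv A x y}"
  using r by (simp_all add: rl_quotient_def rl_congruence_def
      lift2_class[OF rl_congruence_equiv[OF r] _ xy])

lemma rl_quotient_carrier: "carrier (rl_quotient A r) = (\<lambda>x. r `` {x}) ` carrier A"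
  by (auto simp: rl_quotient_def quotient_def)

lemma rl_quotient_one: "\<one>\<^bsub>rl_quotient A r\<^esub> = r `` {\<one>\<^bsub>A\<^esub>}"
  by (simp add: rl_quotient_def)

lemma rl_quotient_hom:
  assumes "rl_congruence A r"
  shows "(\<lambda>x. r `` {x}) \<in> rl_hom A (rl_quotient A r)"
  using rl_quotient_class[OF assms]
  by (auto simp: rl_hom_def hom_def rl_quotient_carrier rl_quotient_one)

text \<open>This is residuation in the quotient, whose order is equality of \<open>a \<and> b\<close> with \<open>a\<close> modulo \<open>r\<close>.
  It follows from true inequalities in \<open>G\<close>: the element \<open>x y \<and> z\<close>, for the forward direction, and
  \<open>y \<and> (x \ z)\<close>, for the converse, lies genuinely below \<open>z\<close> or \<open>x \ z\<close> and is congruent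
  to \<open>x y\<close> or \<open>y\<close> by assumption.\<close>

lemma (in residuated_lattice) congruence_ldiv_iff:
  assumes r: "rl_congruence G r" and c: "x \<in> carrier G" "y \<in> carrier G" "z \<in> carrier G"
  shows "(rl_meet G (x \<otimes> y) z, x \<otimes> y) \<in> r \<longleftrightarrow> (rl_meet G y (rl_ldiv G x z), y) \<in> r"
proof
  let ?w = "rl_meet G (x \<otimes> y) z"
  note cl = c meet_closed ldiv_closed m_closed
  note ops = rl_congruence_ops[OF r] and rr = rl_congruence_refl[OF r]
  assume a: "(?w, x \<otimes> y) \<in> r"
  have "rl_le G (x \<otimes> rl_ldiv G x ?w) ?w"
    by (simp add: cl ldiv_iff le_refl)
  then have "rl_le G (x \<otimes> rl_ldiv G x ?w) z"
    using le_trans[OF _ _ _ _ meet_le2] by (simp add: cl)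
  then have "rl_le G (rl_ldiv G x ?w) (rl_ldiv G x z)"
    by (simp add: cl ldiv_iff)
  then have 1: "rl_meet G (rl_meet G y (rl_ldiv G x ?w)) (rl_ldiv G x z)
      = rl_meet G y (rl_ldiv G x ?w)"
    by (simp add: cl rl_le_def meet_assoc)
  have "rl_le G y (rl_ldiv G x (x \<otimes> y))"
    by (simp add: cl le_refl ldiv_iff[symmetric])
  then have "rl_meet G y (rl_ldiv G x (x \<otimes> y)) = y"
    by (simp add: rl_le_def)
  then have 2: "(rl_meet G y (rl_ldiv G x ?w), y) \<in> r"
    using ops(1)[OF rr[of y] ops(4)[OF rr[of x] a]] by (simp add: cl)
  have "(rl_meet G (rl_meet G y (rl_ldiv G x ?w)) (rl_ldiv G x z),
      rl_meet G y (rl_ldiv G x z)) \<in> r"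
    using ops(1)[OF 2 rr[of "rl_ldiv G x z"]] by (simp add: cl)
  with 1 2 show "(rl_meet G y (rl_ldiv G x z), y) \<in> r"
    using rl_congruence_sym[OF r] rl_congruence_trans[OF r] by metis
next
  let ?v = "rl_meet G y (rl_ldiv G x z)"
  note cl = c meet_closed ldiv_closed m_closed
  note ops = rl_congruence_ops[OF r] and rr = rl_congruence_refl[OF r]
  assume a: "(?v, y) \<in> r"
  have "rl_le G (x \<otimes> ?v) z"
    by (simp add: cl ldiv_iff meet_le2)
  then have 1: "rl_meet G (x \<otimes> ?v) z = x \<otimes> ?v"
    by (simp add: rl_le_def)
  have 2: "(x \<otimes> ?v, x \<otimes> y) \<in> r"
    using ops(3)[OF rr[of x] a] by (simp add: cl)
  then have "(rl_meet G (x \<otimes> ?v) z, rl_meet G (x \<otimes> y) z) \<in> r"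
    using ops(1)[OF _ rr[of z]] by (simp add: cl)
  with 1 2 show "(rl_meet G (x \<otimes> y) z, x \<otimes> y) \<in> r"
    using rl_congruence_sym[OF r] rl_congruence_trans[OF r] by metis
qed

text \<open>Reversing the multiplication exchanges the two divisions, which turns facts about left division
  into facts about right division.\<close>

definition rl_opposite :: "('a, 'm) rl_scheme \<Rightarrow> 'a rl" where
  "rl_opposite A =
     \<lparr>carrier = carrier A, mult = (\<lambda>x y. y \<otimes>\<^bsub>A\<^esub> x), one = \<one>\<^bsub>A\<^esub>,
      rl_meet = rl_meet A, rl_join = rl_join A,
      rl_ldiv = (\<lambda>x y. rl_rdiv A y x), rl_rdiv = (\<lambda>x y. rl_ldiv A y x)\<rparr>"

lemma (in residuated_lattice) residuated_lattice_opposite: "residuated_lattice (rl_opposite G)"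
  by unfold_locales
    (auto simp: rl_opposite_def rl_le_def m_assoc meet_closed join_closed ldiv_closed rdiv_closed
      meet_assoc join_assoc meet_join join_meet ldiv_iff[unfolded rl_le_def]
      rdiv_iff[unfolded rl_le_def, symmetric] intro: meet_comm join_comm)

lemma rl_congruence_opposite: "rl_congruence A r \<Longrightarrow> rl_congruence (rl_opposite A) r"
  by (auto simp: rl_congruence_def compatible_def rl_opposite_def)

lemma (in residuated_lattice) congruence_rdiv_iff:
  assumes "rl_congruence G r" "x \<in> carrier G" "y \<in> carrier G" "z \<in> carrier G"
  shows "(rl_meet G (x \<otimes> y) z, x \<otimes> y) \<in> r \<longleftrightarrow> (rl_meet G x (rl_rdiv G z y), x) \<in> r"
  using residuated_lattice.congruence_ldiv_iff[OF residuated_lattice_opposite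
      rl_congruence_opposite[OF assms(1)], of y x z] assms(2-)
  by (simp add: rl_opposite_def)

lemma (in integral_residuated_lattice) integral_residuated_lattice_quotient:
  assumes r: "rl_congruence G r"
  shows "integral_residuated_lattice (rl_quotient G r)"
proof -
  let ?Q = "rl_quotient G r"
  note eq = eq_equiv_class_iff[OF rl_congruence_equiv[OF r]]
  note cl = meet_closed join_closed ldiv_closed rdiv_closed
  note q = rl_quotient_class[OF r]
  have le: "rl_le ?Q (r `` {x}) (r `` {y}) \<longleftrightarrow> (rl_meet G x y, x) \<in> r"
    if "x \<in> carrier G" "y \<in> carrier G" for x y
    using that by (simp add: rl_le_def q eq cl)
  show ?thesis
    by (unfold_locales;
      auto simp: rl_quotient_carrier rl_quotient_one q le cl m_assoc meet_assoc join_assoc meet_join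
        join_meet congruence_ldiv_iff[OF r, symmetric] congruence_rdiv_iff[OF r, symmetric]
        integral[unfolded rl_le_def] rl_congruence_refl[OF r];
      metis meet_comm join_comm)
qed

text \<open>Birkhoff's argument.  Let \<open>r\<close> be maximal among the congruences that do not identify \<open>x\<close> and \<open>y\<close>.
  Non-identity congruences of the quotient pull back to congruences strictly above \<open>r\<close>, so all of them
  contain the pair of the classes of \<open>x\<close> and \<open>y\<close>.\<close>

lemma (in integral_residuated_lattice) separating_congruence:
  assumes xy: "x \<in> carrier G" "y \<in> carrier G" "x \<noteq> y"
  obtains r where "rl_congruence G r" "(x, y) \<notin> r" "subdirectly_irreducible (rl_quotient G r)"
proof -
  let ?P = "{r. rl_congruence G r \<and> (x, y) \<notin> r}"
  have "rl_congruence G (Id_on (carrier G))"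
    by (auto simp: rl_congruence_def compatible_def meet_closed join_closed ldiv_closed rdiv_closed
        intro!: equivI refl_onI symI transI)
  with xy have ne: "?P \<noteq> {}"
    by auto
  have "\<Union>\<C> \<in> ?P" if "\<C> \<noteq> {}" and ch: "subset.chain ?P \<C>" for \<C>
  proof -
    have cong: "rl_congruence G r" if "r \<in> \<C>" for r
      using ch that by (auto simp: subset.chain_def)
    have both: "\<exists>r\<in>\<C>. p \<in> r \<and> q \<in> r" if "p \<in> \<Union>\<C>" "q \<in> \<Union>\<C>" for p q
      using that ch unfolding subset_chain_def by blast
    have "equiv (carrier G) (\<Union>\<C>)"
    proof (intro equivI)
      show "\<Union>\<C> \<subseteq> carrier G \<times> carrier G"
        using rl_congruence_mem[OF cong] by auto
      show "refl_on (carrier G) (\<Union>\<C>)"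
        using \<open>\<C> \<noteq> {}\<close> rl_congruence_refl[OF cong] by (auto simp: refl_on_def)
      show "sym (\<Union>\<C>)"
        using rl_congruence_sym[OF cong] by (fast intro!: symI)
      show "trans (\<Union>\<C>)"
      proof (rule transI)
        fix a b c assume "(a, b) \<in> \<Union>\<C>" "(b, c) \<in> \<Union>\<C>"
        then obtain r where "r \<in> \<C>" "(a, b) \<in> r" "(b, c) \<in> r"
          using both by blast
        then show "(a, c) \<in> \<Union>\<C>"
          using rl_congruence_trans[OF cong] by blast
      qed
    qed
    moreover have "compatible f (\<Union>\<C>)" if "\<And>r. r \<in> \<C> \<Longrightarrow> compatible f r" for f
      unfolding compatible_def
    proof clarify
      fix a a' R b b' R'
      assume "(a, a') \<in> R" "R \<in> \<C>" "(b, b') \<in> R'" "R' \<in> \<C>"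
      then obtain r where "r \<in> \<C>" "(a, a') \<in> r" "(b, b') \<in> r"
        using both[of "(a, a')" "(b, b')"] by blast
      then show "(f a b, f a' b') \<in> \<Union>\<C>"
        using that unfolding compatible_def by blast
    qed
    ultimately have "rl_congruence G (\<Union>\<C>)"
      using cong by (simp add: rl_congruence_def)
    then show ?thesis
      using ch by (auto simp: subset.chain_def)
  qed
  from subset_Zorn_nonempty[OF ne this] obtain r where "r \<in> ?P" and
    max: "\<And>s. \<lbrakk>s \<in> ?P; r \<subseteq> s\<rbrakk> \<Longrightarrow> s = r"
    by blast
  then have r: "rl_congruence G r" "(x, y) \<notin> r"
    by auto
  interpret Q: integral_residuated_lattice "rl_quotient G r"
    using r(1) by (rule integral_residuated_lattice_quotient)
  let ?q = "\<lambda>x. r `` {x}"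
  note eq = eq_equiv_class_iff[OF rl_congruence_equiv[OF r(1)]]
  have "subdirectly_irreducible (rl_quotient G r)"
  proof (rule Q.subdirectly_irreducibleI)
    show "?q x \<in> carrier (rl_quotient G r)" "?q y \<in> carrier (rl_quotient G r)"
      using xy by (auto simp: rl_quotient_carrier)
    show "?q x \<noteq> ?q y"
      using xy r eq by simp
    fix s assume s: "rl_congruence (rl_quotient G r) s" "s \<noteq> Id_on (carrier (rl_quotient G r))"
    define t where "t = {(a, b) \<in> carrier G \<times> carrier G. (?q a, ?q b) \<in> s}"
    have t: "rl_congruence G t"
      unfolding t_def using rl_quotient_hom[OF r(1)] s(1) by (rule rl_congruence_vimage)
    have "r \<subseteq> t"
    proof clarify
      fix a b assume ab: "(a, b) \<in> r"
      then have "a \<in> carrier G" "b \<in> carrier G"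
        using rl_congruence_mem[OF r(1)] by auto
      moreover have "?q a = ?q b"
        using ab by (rule equiv_class_eq[OF rl_congruence_equiv[OF r(1)]])
      ultimately show "(a, b) \<in> t"
        using rl_congruence_refl[OF s(1)] by (auto simp: t_def rl_quotient_carrier)
    qed
    moreover have "t \<noteq> r"
    proof -
      obtain X Y where XY: "(X, Y) \<in> s" "X \<noteq> Y"
        using s(2) unfolding rl_congruence_not_Id_on[OF s(1)] by blast
      then have "X \<in> carrier (rl_quotient G r)" "Y \<in> carrier (rl_quotient G r)"
        using rl_congruence_mem[OF s(1)] by blast+
      then obtain a b where "a \<in> carrier G" "b \<in> carrier G" "X = ?q a" "Y = ?q b"
        by (auto simp: rl_quotient_carrier)
      with XY show ?thesis
        using eq by (auto simp: t_def)
    qed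
    ultimately have "(x, y) \<in> t"
      using max[of t] t by blast
    then show "(?q x, ?q y) \<in> s"
      by (simp add: t_def)
  qed
  with r show ?thesis
    by (rule that)
qed

section \<open>Invariant sets of indices\<close>

definition invariant :: "'i set \<Rightarrow> ('i \<Rightarrow> 'i) \<Rightarrow> 'i set \<Rightarrow> bool" where
  "invariant I1 l J \<longleftrightarrow> (\<forall>i\<in>I1. l i \<in> J \<longleftrightarrow> i \<in> J)"

text \<open>Viewing \<open>l\<close> as a graph with an edge from each \<open>i\<close> in \<open>I1\<close> to \<open>l i\<close>, the invariant sets are the
  unions of connected components, and this says that there is at most one component.\<close>

definition indecomposable :: "'i set \<Rightarrow> 'i set \<Rightarrow> ('i \<Rightarrow> 'i) \<Rightarrow> bool" where
  "indecomposable I0 I1 l \<longleftrightarrow> (\<forall>J\<subseteq>I0. invariant I1 l J \<longrightarrow> J = {} \<or> J = I0)"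

text \<open>The component of \<open>i\<close> is the least invariant set containing it.  An invariant part of it that
  misses \<open>i\<close> has an invariant complement that contains \<open>i\<close>, hence is empty.\<close>

lemma indecomposable_component:
  assumes "l \<in> I1 \<rightarrow> I0" "I1 \<subseteq> I0" "i \<in> I0"
  obtains C where "i \<in> C" "C \<subseteq> I0" "invariant I1 l C" "indecomposable C (I1 \<inter> C) l"
proof -
  define C where "C = \<Inter>{J. i \<in> J \<and> J \<subseteq> I0 \<and> invariant I1 l J}"
  have "invariant I1 l I0"
    using assms by (auto simp: invariant_def)
  then have C: "i \<in> C" "C \<subseteq> I0"
    using assms(3) by (auto simp: C_def)
  have inv: "invariant I1 l C"
    by (simp add: C_def invariant_def)
  have least: "C \<subseteq> J" if "i \<in> J" "J \<subseteq> I0" "invariant I1 l J" for J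
    using that by (auto simp: C_def)
  have "indecomposable C (I1 \<inter> C) l"
    unfolding indecomposable_def
  proof (intro allI impI)
    fix J assume J: "J \<subseteq> C" "invariant (I1 \<inter> C) l J"
    have J': "invariant I1 l J"
      using J inv unfolding invariant_def by blast
    show "J = {} \<or> J = C"
    proof (cases "i \<in> J")
      case True
      then show ?thesis
        using least[of J] J J' C by auto
    next
      case False
      have "invariant I1 l (C - J)"
        using inv J' by (simp add: invariant_def)
      then show ?thesis
        using least[of "C - J"] False J C by auto
    qed
  qed
  with C inv show ?thesis
    by (rule that)
qed

section \<open>Homomorphisms between kites\<close>

lemma kite_carrier:
  "p \<in> carrier (kite G I0 I1 l) \<longleftrightarrow> snd p \<in> kite_index I0 I1 l (fst p) \<rightarrow>\<^sub>E carrier G"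
  by (cases p) (auto simp: kite_def Let_def)

lemma kite_index_invariant:
  assumes "C \<subseteq> I0" "I1 \<subseteq> I0" "invariant I1 l C"
  shows "kite_index C (I1 \<inter> C) l n = kite_index I0 I1 l n \<inter> C"
proof (induction n)
  case (Suc n)
  then show ?case
  proof (cases n)
    case (Suc k)
    have "kite_index I0 I1 l (Suc k) \<subseteq> I1"
      by (induction k) auto
    then show ?thesis
      using Suc Suc.IH assms(3) by (auto simp: invariant_def)
  qed simp
qed (use assms in auto)

text \<open>The sets \<open>I\<^sub>n\<close> shrink, so membership in \<open>I\<^sub>n\<^sub>+\<^sub>1\<close>
  means that \<open>l\<close> can be applied \<open>n + 1\<close> times, and the first application can be split off.\<close>

lemma kite_index_Suc: "I1 \<subseteq> I0 \<Longrightarrow> l \<in> I1 \<rightarrow> I0 \<Longrightarrow>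
  kite_index I0 I1 l (Suc n) = {i \<in> I1. l i \<in> kite_index I0 I1 l n}"
proof (induction n)
  case (Suc n)
  moreover have "kite_index I0 I1 l (Suc n) \<subseteq> kite_index I0 I1 l n"
    using Suc.prems by (cases n) auto
  ultimately show ?case
    by auto
qed auto

lemma invariant_funpow:
  assumes "I1 \<subseteq> I0" "l \<in> I1 \<rightarrow> I0" "invariant I1 l C" "i \<in> kite_index I0 I1 l n"
  shows "(l ^^ n) i \<in> C \<longleftrightarrow> i \<in> C"
  using assms(4)
proof (induction n arbitrary: i)
  case (Suc n)
  then have "i \<in> I1" "l i \<in> kite_index I0 I1 l n"
    by (simp_all add: kite_index_Suc[OF assms(1,2)] del: kite_index.simps)
  then show ?case
    using Suc.IH[of "l i"] assms(3)
    by (simp add: invariant_def funpow_Suc_right del: funpow.simps)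
qed simp

definition kite_map ::
    "('g \<Rightarrow> 'h) \<Rightarrow> 'i set \<Rightarrow> 'i set \<Rightarrow> ('i \<Rightarrow> 'i) \<Rightarrow> nat \<times> ('i \<Rightarrow> 'g) \<Rightarrow> nat \<times> ('i \<Rightarrow> 'h)" where
  "kite_map q C0 C1 l = (\<lambda>(n, x). (n, \<lambda>i\<in>kite_index C0 C1 l n. q (x i)))"

context
  fixes I0 I1 C :: "'i set" and l :: "'i \<Rightarrow> 'i"
  assumes sub: "I1 \<subseteq> I0" and map: "l \<in> I1 \<rightarrow> I0" and inj: "inj_on l I1"
    and C: "C \<subseteq> I0" "invariant I1 l C"
begin

lemma subkite_index: "I1 \<inter> C \<subseteq> C" "l \<in> I1 \<inter> C \<rightarrow> C" "inj_on l (I1 \<inter> C)"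
  using C inj by (auto simp: invariant_def intro: inj_on_subset)

text \<open>All operations compute the coordinate \<open>i\<close> from coordinates on the \<open>l\<close>-orbit of \<open>i\<close>, which
  stays inside \<open>C\<close> or outside of it.  The one delicate point is right division, where the smaller kite
  has its own default case and its own partial inverse of \<open>l\<close>; invariance makes them agree with the
  original ones on \<open>C\<close>.\<close>

lemma kite_map_hom:
  assumes q: "q \<in> rl_hom G H"
  shows "kite_map q C (I1 \<inter> C) l \<in> rl_hom (kite G I0 I1 l) (kite H C (I1 \<inter> C) l)"
proof -
  let ?I = "kite_index I0 I1 l" and ?J = "kite_index C (I1 \<inter> C) l"
  let ?K = "kite G I0 I1 l" and ?L = "kite H C (I1 \<inter> C) l" and ?h = "kite_map q C (I1 \<inter> C) l"
  note qD = rl_homD[OF q] and kd = kite_def Let_def kite_map_def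
  have J: "?J n = ?I n \<inter> C" for n
    using C sub by (intro kite_index_invariant)
  have JI: "i \<in> ?I n" if "i \<in> ?J n" for i n
    using that J by blast
  have anti: "i \<in> ?J n" if "i \<in> ?J m" "n \<le> m" for i m n
    using that kite_index_antimono[OF subkite_index] by blast
  have fpow: "(l ^^ n) i \<in> ?J m" if "i \<in> ?J (m + n)" for i m n
    using that by (rule kite_index_funpow[OF subkite_index])
  have ops: "?h (x \<otimes>\<^bsub>?K\<^esub> y) = ?h x \<otimes>\<^bsub>?L\<^esub> ?h y \<and>
      ?h (rl_meet ?K x y) = rl_meet ?L (?h x) (?h y) \<and>
      ?h (rl_join ?K x y) = rl_join ?L (?h x) (?h y) \<and>
      ?h (rl_ldiv ?K x y) = rl_ldiv ?L (?h x) (?h y) \<and>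
      ?h (rl_rdiv ?K x y) = rl_rdiv ?L (?h x) (?h y)"
    if xy: "x \<in> carrier ?K" "y \<in> carrier ?K" for x y
  proof -
    obtain m x' n y' where e: "x = (m, x')" "y = (n, y')"
      by (metis surj_pair)
    have cx: "x' i \<in> carrier G" if "i \<in> ?I m" for i
      using xy(1) that by (auto simp: e kite_carrier)
    have cy: "y' i \<in> carrier G" if "i \<in> ?I n" for i
      using xy(2) that by (auto simp: e kite_carrier)
    have "?h (x \<otimes>\<^bsub>?K\<^esub> y) = ?h x \<otimes>\<^bsub>?L\<^esub> ?h y"
      using JI fpow[of _ m n] anti[of _ "m + n" n] qD cx cy
      by (auto simp: e kd intro!: restrict_ext)
    moreover have "?h (rl_meet ?K x y) = rl_meet ?L (?h x) (?h y)"
      "?h (rl_join ?K x y) = rl_join ?L (?h x) (?h y)"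
      using JI qD cx cy by (auto simp: e kd intro!: restrict_ext)
    moreover have "?h (rl_ldiv ?K x y) = rl_ldiv ?L (?h x) (?h y)"
    proof (cases "m > n")
      case True
      then show ?thesis
        using qD(2) by (auto simp: e kd J intro!: restrict_ext simp del: kite_index.simps)
    next
      case False
      then have "(l ^^ (n - m)) i \<in> ?J m" if "i \<in> ?J n" for i
        using fpow[of i m "n - m"] that by simp
      then show ?thesis
        using False JI qD cx cy by (auto simp: e kd J intro!: restrict_ext)
    qed
    moreover have "?h (rl_rdiv ?K x y) = rl_rdiv ?L (?h x) (?h y)"
    proof (cases "n > m")
      case True
      then show ?thesis
        using qD(2) by (auto simp: e kd J intro!: restrict_ext simp del: kite_index.simps)
    next
      case False
      have inv: "inv_into (?I n) (l ^^ n) ((l ^^ n) j) = j" if "j \<in> ?I m" for j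
        using False that by (intro kite_index_inv[OF sub map inj]) auto
      have inv': "inv_into (?J n) (l ^^ n) ((l ^^ n) j) = j" if "j \<in> ?J m" for j
        using False that by (intro kite_index_inv[OF subkite_index]) auto
      have C': "(l ^^ n) j \<in> C \<longleftrightarrow> j \<in> C" if "j \<in> ?I m" for j
        using that False kite_index_antimono[OF sub map inj, of n m]
        by (intro invariant_funpow[OF sub map C(2)]) auto
      have "q (if i \<in> (l ^^ n) ` ?I m
            then rl_rdiv G (x' (inv_into (?I n) (l ^^ n) i)) (y' (inv_into (?I n) (l ^^ n) i))
            else \<one>\<^bsub>G\<^esub>) =
          (if i \<in> (l ^^ n) ` ?J m
            then rl_rdiv H (restrict (\<lambda>i. q (x' i)) (?J m) (inv_into (?J n) (l ^^ n) i))
              (restrict (\<lambda>i. q (y' i)) (?J n) (inv_into (?J n) (l ^^ n) i))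
            else \<one>\<^bsub>H\<^esub>)" if "i \<in> ?J (m - n)" for i
      proof (cases "i \<in> (l ^^ n) ` ?I m")
        case True
        then obtain j where j: "i = (l ^^ n) j" "j \<in> ?I m"
          by blast
        then have "j \<in> ?J m"
          using C' that J by auto
        moreover from this have "j \<in> ?J n"
          using False anti by simp
        ultimately show ?thesis
          using j inv inv' qD(7) cx cy JI by auto
      next
        case False
        then have "i \<notin> (l ^^ n) ` ?J m"
          using JI by blast
        with False show ?thesis
          using qD(2) by simp
      qed
      then show ?thesis
        using False JI by (auto simp: e kd intro!: restrict_ext)
    qed
    ultimately show ?thesis
      by blast
  qed
  have "?h x \<in> carrier ?L" if "x \<in> carrier ?K" for x
    using that qD(1) JI by (cases x) (auto simp: kite_carrier kite_map_def)
  moreover have "?h \<one>\<^bsub>?K\<^esub> = \<one>\<^bsub>?L\<^esub>"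
    using qD(2) C by (auto simp: kd intro!: restrict_ext)
  ultimately show ?thesis
    using ops by (auto simp: rl_hom_def hom_def)
qed

lemma kite_map_surj:
  assumes q: "q ` carrier G = carrier H"
    and one: "\<one>\<^bsub>G\<^esub> \<in> carrier G"
  shows "kite_map q C (I1 \<inter> C) l ` carrier (kite G I0 I1 l) = carrier (kite H C (I1 \<inter> C) l)"
    (is "?h ` carrier ?K = carrier ?L")
proof
  have J: "kite_index C (I1 \<inter> C) l n = kite_index I0 I1 l n \<inter> C" for n
    using C sub by (intro kite_index_invariant)
  show "?h ` carrier ?K \<subseteq> carrier ?L"
    by (auto simp: kite_carrier kite_map_def J q[symmetric] intro!: imageI dest: PiE_mem)
  show "carrier ?L \<subseteq> ?h ` carrier ?K"
  proof
    fix p assume p: "p \<in> carrier ?L"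
    obtain n y where e: "p = (n, y)"
      by (metis surj_pair)
    have y: "y \<in> kite_index I0 I1 l n \<inter> C \<rightarrow>\<^sub>E carrier H"
      using p by (simp add: e kite_carrier J)
    \<comment> \<open>Outside \<open>C\<close> any value serves, as those coordinates are forgotten.\<close>
    define x where "x = (\<lambda>i\<in>kite_index I0 I1 l n.
      if i \<in> C then inv_into (carrier G) q (y i) else \<one>\<^bsub>G\<^esub>)"
    have inv: "inv_into (carrier G) q z \<in> carrier G" "q (inv_into (carrier G) q z) = z"
      if "z \<in> carrier H" for z
      using that q by (auto intro: inv_into_into f_inv_into_f)
    have "y i \<in> carrier H" if "i \<in> kite_index I0 I1 l n" "i \<in> C" for i
      using y that by auto
    then have "(n, x) \<in> carrier ?K"
      using inv(1) one by (auto simp: kite_carrier x_def)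
    moreover have "?h (n, x) = p"
      using y inv(2)
      by (auto simp: e kite_map_def J x_def fun_eq_iff restrict_def PiE_def extensional_def)
    ultimately show "p \<in> ?h ` carrier ?K"
      by force
  qed
qed

end

section \<open>Subdirectly irreducible kites\<close>

text \<open>As \<open>g\<close> varies, these elements form a copy of \<open>G\<close> at the coordinate \<open>i\<close> of level \<open>0\<close>.\<close>

definition single :: "('g, 'm) rl_scheme \<Rightarrow> 'i set \<Rightarrow> 'i \<Rightarrow> 'g \<Rightarrow> nat \<times> ('i \<Rightarrow> 'g)" where
  "single G I0 i g = (0, \<lambda>j\<in>I0. if j = i then g else \<one>\<^bsub>G\<^esub>)"

text \<open>On level \<open>0\<close> all operations are coordinatewise, and the unit, which fills the
  other coordinates, is idempotent for each of them.\<close>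

lemma (in integral_residuated_lattice) single_hom:
  "single G I0 i \<in> rl_hom G (kite G I0 I1 l)"
proof -
  have "inv_into I0 id j = j" if "j \<in> I0" for j
    using inv_into_f_f[of id I0 j] that by simp
  then show ?thesis
    by (auto simp: rl_hom_def hom_def single_def kite_def Let_def fun_eq_iff restrict_def meet_idem
        join_idem ldiv_self rdiv_self)
qed

text \<open>For nonempty \<open>I0\<close>, the pair common to all non-identity congruences is formed by the unit and the tuple with a
  single coordinate \<open>a\<close>, where the monolith of \<open>G\<close>, its least non-identity congruence, identifies
  \<open>a\<close> with the unit.  The set \<open>J\<close> of those coordinates
  at which a given non-identity congruence collapses this tuple is nonempty and invariant, hence everything.\<close>

lemma kite_subdirectly_irreducible:
  fixes G :: "('g, 'm) rl_scheme"
  assumes "integral_residuated_lattice G"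
    and I: "I1 \<subseteq> I0" "l \<in> I1 \<rightarrow> I0" "inj_on l I1"
    and indec: "indecomposable I0 I1 l"
    and si: "I0 \<noteq> {} \<Longrightarrow> subdirectly_irreducible G"
  shows "subdirectly_irreducible (kite G I0 I1 l)"
proof -
  interpret G: integral_residuated_lattice G by fact
  let ?K = "kite G I0 I1 l" and ?I = "kite_index I0 I1 l"
  interpret K: integral_residuated_lattice ?K
    using I assms(1) by (rule kite_integral_residuated_lattice)
  note kd = kite_def Let_def
  have one: "\<one>\<^bsub>?K\<^esub> = (0, \<lambda>i\<in>I0. \<one>\<^bsub>G\<^esub>)"
    by (simp add: kd)
  show ?thesis
  proof (cases "I0 = {}")
    case True
    have empty: "?I n = {}" for n
      using kite_index_antimono[OF I, of 0 n] True by simp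
    \<comment> \<open>The greatest element below the unit; \<open>undefined\<close> everywhere is the empty tuple.\<close>
    let ?p = "(Suc 0, \<lambda>_. undefined)"
    show ?thesis
    proof (rule K.subdirectly_irreducibleI)
      show p: "?p \<in> carrier ?K"
        using empty[of "Suc 0"] by (auto simp: kite_carrier)
      show "\<one>\<^bsub>?K\<^esub> \<in> carrier ?K"
        by simp
      show "?p \<noteq> \<one>\<^bsub>?K\<^esub>"
        by (simp add: one)
      fix s assume s: "rl_congruence ?K s" "s \<noteq> Id_on (carrier ?K)"
      then obtain c where c: "c \<noteq> \<one>\<^bsub>?K\<^esub>" "(c, \<one>\<^bsub>?K\<^esub>) \<in> s"
        by (rule K.congruence_one_pair)
      have cK: "c \<in> carrier ?K"
        using rl_congruence_mem[OF s(1) c(2)] by simp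
      have "c = (fst c, \<lambda>_. undefined)"
        using cK empty[of "fst c"] by (cases c) (auto simp: kite_carrier)
      moreover have "\<one>\<^bsub>?K\<^esub> = (0, \<lambda>_. undefined)"
        using one True by (simp add: restrict_def)
      ultimately obtain n where n: "c = (Suc n, \<lambda>_. undefined)"
        using c(1) by (metis not0_implies_Suc)
      have "rl_le ?K c ?p"
        using cK p I(1) True unfolding n by (cases n) (auto simp: kite_le_iff empty)
      then show "(?p, \<one>\<^bsub>?K\<^esub>) \<in> s"
        using K.congruence_one_upward[OF s(1) c(2) p] by simp
    qed
  next
    case False
    then obtain i0 where i0: "i0 \<in> I0"
      by blast
    obtain a where a: "a \<in> carrier G" "a \<noteq> \<one>\<^bsub>G\<^esub>"
      and crit: "\<And>s. \<lbrakk>rl_congruence G s; s \<noteq> Id_on (carrier G)\<rbrakk> \<Longrightarrow> (a, \<one>\<^bsub>G\<^esub>) \<in> s"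
      using G.subdirectly_irreducible_one_pair[OF si[OF False]] by blast
    let ?d = "single G I0"
    note dhom = rl_homD[OF G.single_hom[of I0 _ I1 l]]
    show ?thesis
    proof (rule K.subdirectly_irreducibleI)
      show "?d i0 a \<in> carrier ?K"
        using dhom(1) a by blast
      show "\<one>\<^bsub>?K\<^esub> \<in> carrier ?K"
        by simp
      show "?d i0 a \<noteq> \<one>\<^bsub>?K\<^esub>"
        using i0 a by (auto simp: single_def one fun_eq_iff restrict_def)
      fix s assume s: "rl_congruence ?K s" "s \<noteq> Id_on (carrier ?K)"
      then obtain c where c: "c \<noteq> \<one>\<^bsub>?K\<^esub>" "(c, \<one>\<^bsub>?K\<^esub>) \<in> s"
        by (rule K.congruence_one_pair)
      have cK: "c \<in> carrier ?K"
        using rl_congruence_mem[OF s(1) c(2)] by simp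
      obtain n x where nx: "c = (n, x)"
        by (metis surj_pair)
      define J where "J = {i \<in> I0. (?d i a, \<one>\<^bsub>?K\<^esub>) \<in> s}"
      have "J \<noteq> {}"
      proof (cases "n = 0")
        case True
        have x: "x \<in> I0 \<rightarrow>\<^sub>E carrier G"
          using cK by (simp add: kite_carrier nx True)
        obtain i where i: "i \<in> I0" "x i \<noteq> \<one>\<^bsub>G\<^esub>"
          using c(1) x
          by (auto simp: nx True one fun_eq_iff restrict_def PiE_def extensional_def split: if_splits)
        have xj: "x j \<in> carrier G" if "j \<in> I0" for j
          using x that by auto
        note xi = xj[OF i(1)]
        \<comment> \<open>Replacing all other coordinates of \<open>c\<close> by the unit gives a larger element.\<close>
        have "rl_le ?K c (?d i (x i))"
          using cK dhom(1)[OF xi] xj i(1)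
          by (auto simp: nx True single_def kite_le_iff G.le_refl G.integral)
        then have "(?d i (x i), ?d i \<one>\<^bsub>G\<^esub>) \<in> s"
          using K.congruence_one_upward[OF s(1) c(2) dhom(1)[OF xi]] dhom(2) by simp
        moreover have t: "rl_congruence G {(g, h) \<in> carrier G \<times> carrier G. (?d i g, ?d i h) \<in> s}"
          using G.single_hom s(1) by (rule G.rl_congruence_vimage)
        ultimately have "(a, \<one>\<^bsub>G\<^esub>) \<in> {(g, h) \<in> carrier G \<times> carrier G. (?d i g, ?d i h) \<in> s}"
          using xi i by (intro crit) (auto simp: rl_congruence_not_Id_on)
        then show ?thesis
          using i dhom(2) by (auto simp: J_def)
      next
        case False
        \<comment> \<open>An element of positive level lies below all of level \<open>0\<close>.\<close>
        then have "rl_le ?K c (?d i0 a)"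
          using cK dhom(1)[OF a(1), of i0] by (simp add: nx single_def kite_le_iff)
        then have "i0 \<in> J"
          using K.congruence_one_upward[OF s(1) c(2) dhom(1)[OF a(1)]] i0 by (simp add: J_def)
        then show ?thesis
          by blast
      qed
      moreover have "invariant I1 l J"
        unfolding invariant_def
      proof
        fix i assume i: "i \<in> I1"
        \<comment> \<open>Multiplying by \<open>u\<close> on one side and dividing by it on the other shifts
          coordinates by one step of \<open>l\<close>, and leaves the unit unchanged.\<close>
        let ?u = "(Suc 0, \<lambda>i\<in>I1. \<one>\<^bsub>G\<^esub>)"
        have u: "?u \<in> carrier ?K"
          by (auto simp: kite_carrier)
        note urefl = rl_congruence_refl[OF s(1) u]
        have li: "l j = l i \<longleftrightarrow> j = i" if "j \<in> I1" for j
          using that i I(3) by (auto dest: inj_onD)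
        have 1: "rl_ldiv ?K ?u (?d (l i) a \<otimes>\<^bsub>?K\<^esub> ?u) = ?d i a"
          using I i a li by (auto simp: kd single_def G.ldiv_one intro!: restrict_ext)
        have 2: "rl_rdiv ?K (?u \<otimes>\<^bsub>?K\<^esub> ?d i a) ?u = ?d (l i) a"
          using I i a li by (auto simp: kd single_def G.rdiv_one inv_into_f_f intro!: restrict_ext)
        have "(?d i a, \<one>\<^bsub>?K\<^esub>) \<in> s" if "(?d (l i) a, \<one>\<^bsub>?K\<^esub>) \<in> s"
          using rl_congruence_ops(4)[OF s(1) urefl rl_congruence_ops(3)[OF s(1) that urefl]] u
          by (simp add: 1 K.ldiv_self)
        moreover have "(?d (l i) a, \<one>\<^bsub>?K\<^esub>) \<in> s" if "(?d i a, \<one>\<^bsub>?K\<^esub>) \<in> s"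
          using rl_congruence_ops(5)[OF s(1) rl_congruence_ops(3)[OF s(1) urefl that] urefl] u
          by (simp add: 2 K.rdiv_self)
        ultimately show "l i \<in> J \<longleftrightarrow> i \<in> J"
          using i I by (auto simp: J_def)
      qed
      moreover have "J \<subseteq> I0"
        by (auto simp: J_def)
      ultimately have "J = I0"
        using indec unfolding indecomposable_def by blast
      then show "(?d i0 a, \<one>\<^bsub>?K\<^esub>) \<in> s"
        using i0 unfolding J_def by blast
    qed
  qed
qed

theorem theorem5p13:
  fixes A :: "(nat \<times> ('i \<Rightarrow> 'g)) rl"
  assumes "is_kite A"
  shows "\<exists>(S :: ('i set \<times> 'g rel) set) (F :: 'i set \<times> 'g rel \<Rightarrow> (nat \<times> ('i \<Rightarrow> 'g set)) rl).
           (\<forall>s\<in>S. is_kite (F s) \<and> subdirectly_irreducible (F s)) \<and>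
           subdirect_product A S F"
proof -
  obtain G :: "'g rl" and I0 I1 l where G: "integral_residuated_lattice G"
    and I: "I1 \<subseteq> I0" "l \<in> I1 \<rightarrow> I0" "inj_on l I1" and A: "A = kite G I0 I1 l"
    using assms unfolding is_kite_def by blast
  interpret G: integral_residuated_lattice G by fact
  define S where "S = {(C, r). C \<subseteq> I0 \<and> invariant I1 l C \<and> indecomposable C (I1 \<inter> C) l \<and>
    rl_congruence G r \<and> (C \<noteq> {} \<longrightarrow> subdirectly_irreducible (rl_quotient G r))}"
  define F where "F = (\<lambda>(C, r). kite (rl_quotient G r) C (I1 \<inter> C) l)"
  define f where "f = (\<lambda>(C, r :: 'g rel). kite_map (\<lambda>x. r `` {x}) C (I1 \<inter> C) l)"
  have "is_kite (F s) \<and> subdirectly_irreducible (F s) \<and> f s \<in> rl_hom A (F s) \<and>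
    f s ` carrier A = carrier (F s)" if "s \<in> S" for s
  proof -
    obtain C r where s: "s = (C, r)" and C: "C \<subseteq> I0" "invariant I1 l C"
      and indec: "indecomposable C (I1 \<inter> C) l" and r: "rl_congruence G r"
      and si: "C \<noteq> {} \<Longrightarrow> subdirectly_irreducible (rl_quotient G r)"
      using \<open>s \<in> S\<close> by (auto simp: S_def)
    note sub = subkite_index[OF I C]
    have Q: "integral_residuated_lattice (rl_quotient G r)"
      using r by (rule G.integral_residuated_lattice_quotient)
    have "is_kite (F s)"
      unfolding is_kite_def s F_def prod.case using Q sub by blast
    moreover have "subdirectly_irreducible (F s)"
      using kite_subdirectly_irreducible[OF Q sub indec si] by (simp add: s F_def)
    moreover have "f s \<in> rl_hom A (F s)"
      using kite_map_hom[OF I C rl_quotient_hom[OF r]] by (simp add: s F_def f_def A)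
    moreover have "f s ` carrier A = carrier (F s)"
      using kite_map_surj[OF I C rl_quotient_carrier[symmetric] G.one_closed]
      by (simp add: s F_def f_def A)
    ultimately show ?thesis
      by blast
  qed
  moreover have "subdirect_product A S F"
  proof (rule subdirect_productI)
    fix x y assume xy: "x \<in> carrier A" "y \<in> carrier A" "x \<noteq> y"
    obtain m x' n y' where e: "x = (m, x')" "y = (n, y')"
      by (metis surj_pair)
    show "\<exists>s\<in>S. f s x \<noteq> f s y"
    proof (cases "m = n")
      case False
      \<comment> \<open>Over the empty index set the congruence is arbitrary: there are no coordinates.\<close>
      have "({}, carrier G \<times> carrier G) \<in> S"
        using G.rl_congruence_total by (auto simp: S_def invariant_def indecomposable_def)
      then show ?thesis
        using False by (force simp: f_def kite_map_def e)
    next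
      case True
      have c: "x' \<in> kite_index I0 I1 l n \<rightarrow>\<^sub>E carrier G" "y' \<in> kite_index I0 I1 l n \<rightarrow>\<^sub>E carrier G"
        using xy(1,2) True by (simp_all add: A e kite_carrier)
      then obtain i where i: "i \<in> kite_index I0 I1 l n" "x' i \<noteq> y' i"
        using xy(3) True PiE_ext[OF c] by (auto simp: e)
      have "i \<in> I0"
        using i kite_index_antimono[OF I, of 0 n] by auto
      then obtain C where C: "i \<in> C" "C \<subseteq> I0" "invariant I1 l C"
        "indecomposable C (I1 \<inter> C) l"
        by (rule indecomposable_component[OF I(2,1)])
      have xyi: "x' i \<in> carrier G" "y' i \<in> carrier G"
        using c i by auto
      then obtain r where r: "rl_congruence G r" "(x' i, y' i) \<notin> r"
        "subdirectly_irreducible (rl_quotient G r)"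
        using i(2) by (rule G.separating_congruence)
      have "(C, r) \<in> S"
        using C r by (simp add: S_def)
      moreover have "f (C, r) x \<noteq> f (C, r) y"
      proof
        assume eq: "f (C, r) x = f (C, r) y"
        have iJ: "i \<in> kite_index C (I1 \<inter> C) l n" (is "i \<in> ?J")
          using i C kite_index_invariant[OF C(2) I(1) C(3)] by simp
        have "(\<lambda>i\<in>?J. r `` {x' i}) = (\<lambda>i\<in>?J. r `` {y' i})"
          using eq by (simp add: f_def kite_map_def e True)
        from fun_cong[OF this, of i] have "r `` {x' i} = r `` {y' i}"
          using iJ by simp
        then show False
          using r(2) eq_equiv_class_iff[OF rl_congruence_equiv[OF r(1)] xyi] by simp
      qed
      ultimately show ?thesis
        by blast
    qed
  qed (use calculation in auto)
  ultimately show ?thesis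
    by blast
qed

end
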